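(* Let $a,b,c,d$ be positive real numbers with $\min\{c,d\}>\max\{a,b\}$, and let $\{P_n(x)\}_{n\in\mathbb{N}}$, $P_n(x):=P_n(x;a,b;c,d)$, be the monic $2$-orthogonal polynomial sequence with respect to the weight vector $\overline{\mathcal{W}}(x;a,b;c,d)$. Let $c'_n=c+k$ if $n=2k-1$ and $c'_n=d+k$ if $n=2k$ ($k\in\mathbb{N}$), and for $n\in\mathbb{N}$ define $$\lambda_{3n}=\frac{n(b+n-1)(c'_n-a-1)}{(c'_n+n-2)(c'_n+n-1)(c'_{n-1}+n-1)},$$ $$\lambda_{3n+1}=\frac{n(a+n)(c'_{n-1}-b)}{(c'_n+n-1)(c'_{n-1}+n-1)(c'_{n-1}+n)},$$ $$\lambda_{3n+2}=\frac{(a+n)(b+n)(c'_n-1)}{(c'_n+n-1)(c'_n+n)(c'_{n-1}+n)},$$ where for $n=0$ this is read as $\lambda_0=\lambda_1=0$ and $\lambda_2=\frac{ab}{cd}$. Then, with $P_{-2}=P_{-1}=0$ and $P_0=1$, for all $n\in\mathbb{N}$, $$P_{n+1}(x)=(x-\beta_n)P_n(x)-\alpha_nP_{n-1}(x)-\gamma_{n-1}P_{n-2}(x),$$ with coefficients given, for all $n\in\mathbb{N}$, by $$\beta_n=\lambda_{3n}+\lambda_{3n+1}+\lambda_{3n+2},$$ $$\alpha_{n+1}=\lambda_{3n+1}\lambda_{3n+3}+\lambda_{3n+2}\lambda_{3n+3}+\lambda_{3n+2}\lambda_{3n+4},$$ $$\gamma_{n+1}=\lambda_{3n+2}\lambda_{3n+4}\lambda_{3n+6}.$$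 Consequently, the recurrence coefficients $\beta_n,\alpha_{n+1},\gamma_{n+1}$ ($n\in\mathbb{N}$) are real, positive and bounded, and, as $n\to\infty$, $$\beta_n\to 3\left(\tfrac{4}{27}\right)=\tfrac49,\qquad \alpha_n\to3\left(\tfrac4{27}\right)^2=\tfrac{16}{243},\qquad \gamma_n\to\left(\tfrac4{27}\right)^3=\tfrac{64}{19683}.$$
   Context: $\mathbb{N}=\{0,1,2,\dots\}$. For positive reals $a,b,c,d$ with $\delta:=c+d-a-b>0$, the function $\mathcal{W}(\cdot\,;a,b;c,d)$ on $(0,1)$ is $$\mathcal{W}(x;a,b;c,d)=\frac{\Gamma(c)\Gamma(d)}{\Gamma(a)\Gamma(b)\Gamma(\delta)}\,x^{a-1}(1-x)^{\delta-1}\,{}_2F_1(c-b,d-b;\delta;1-x),$$ where ${}_2F_1(\alpha,\beta;\gamma;z)=\sum_{n\ge0}\frac{(\alpha)_n(\beta)_n}{(\gamma)_n}\frac{z^n}{n!}$ for $|z|<1$, with $(z)_0=1$, $(z)_n=z(z+1)\cdots(z+n-1)$. (The condition $\min\{c,d\}>\max\{a,b\}$ implies $\delta>0$.) The weight vector $\overline{\mathcal{W}}(x;a,b;c,d)$ has components $w_0(x)=\mathcal{W}(x;a,b;c,d)$ and $w_1(x)=\mathcal{W}(x;a,b+1;c+1,d)$. A sequence of monic polynomials $\{P_n\}_{n\in\mathbb{N}}$ with $\deg P_n=n$ is the monic $2$-orthogonal polynomial sequence with respect to $\overline{\mathcal{W}}(x;a,b;c,d)$ if, for each $j\in\{0,1\}$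 and $k,n\in\mathbb{N}$, $\int_0^1x^kP_n(x)w_j(x)\,\mathrm{d}x$ equals $0$ if $n\ge 2k+j+1$ and is nonzero if $n=2k+j$. For these weights it exists and is unique. The values of $\alpha_0,\gamma_{-1},\gamma_0$ are irrelevant since they multiply zero polynomials. *)

theory Defs
  imports "HOL-Analysis.Analysis" "HOL-Computational_Algebra.Polynomial"
begin

(* Only meaningful for |z| < 1, where the series converges. *)
definition hypergeom_2F1 :: "real \<Rightarrow> real \<Rightarrow> real \<Rightarrow> real \<Rightarrow> real" where
  "hypergeom_2F1 \<alpha> \<beta> \<gamma> z =
     (\<Sum>n. pochhammer \<alpha> n * pochhammer \<beta> n / pochhammer \<gamma> n * (z ^ n / fact n))"

(* The weight function on the open interval (0,1); its values elsewhere are never used. *)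
definition weight_W :: "real \<Rightarrow> real \<Rightarrow> real \<Rightarrow> real \<Rightarrow> real \<Rightarrow> real" where
  "weight_W a b c d x =
     (let \<delta> = c + d - a - b in
        Gamma c * Gamma d / (Gamma a * Gamma b * Gamma \<delta>)
        * x powr (a - 1) * (1 - x) powr (\<delta> - 1) * hypergeom_2F1 (c - b) (d - b) \<delta> (1 - x))"

(* Components w_0, w_1 of the weight vector; only the indices 0 and 1 are used. *)
definition weight_vector :: "real \<Rightarrow> real \<Rightarrow> real \<Rightarrow> real \<Rightarrow> nat \<Rightarrow> real \<Rightarrow> real" where
  "weight_vector a b c d j =
     (if j = 0 then weight_W a b c d else weight_W a (b + 1) (c + 1) d)"

definition monic_2_orthogonal :: "(nat \<Rightarrow> real \<Rightarrow> real) \<Rightarrow> (nat \<Rightarrow> real poly) \<Rightarrow> bool" where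
  "monic_2_orthogonal w P \<longleftrightarrow>
     (\<forall>n. degree (P n) = n \<and> lead_coeff (P n) = 1) \<and>
     (\<forall>j\<in>{0, 1}. \<forall>k n.
        (n \<ge> 2 * k + j + 1 \<longrightarrow> (LBINT x:{0<..<1}. x ^ k * poly (P n) x * w j x) = 0) \<and>
        (n = 2 * k + j \<longrightarrow> (LBINT x:{0<..<1}. x ^ k * poly (P n) x * w j x) \<noteq> 0))"

(* The shifted parameters c'_n. The index is an integer because c'_{-1} = c is needed. *)
definition cprime :: "real \<Rightarrow> real \<Rightarrow> int \<Rightarrow> real" where
  "cprime c d n = (if odd n then c + of_int ((n + 1) div 2) else d + of_int (n div 2))"

lemma cprime_odd: "cprime c d (2 * int k - 1) = c + real k"
  by (simp add: cprime_def)

lemma cprime_even: "cprime c d (2 * int k) = d + real k"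
  by (simp add: cprime_def)

(* lam a b c d m is lambda_m. The block n = 0 is separate because the general formulas
   may have vanishing denominators there. *)
definition lam :: "real \<Rightarrow> real \<Rightarrow> real \<Rightarrow> real \<Rightarrow> nat \<Rightarrow> real" where
  "lam a b c d m =
     (let n = m div 3; r = real n; p = cprime c d (int n); q = cprime c d (int n - 1) in
      if n = 0 then (if m = 2 then a * b / (c * d) else 0)
      else if m mod 3 = 0 then
        r * (b + r - 1) * (p - a - 1) / ((p + r - 2) * (p + r - 1) * (q + r - 1))
      else if m mod 3 = 1 then
        r * (a + r) * (q - b) / ((p + r - 1) * (q + r - 1) * (q + r))
      else
        (a + r) * (b + r) * (p - 1) / ((p + r - 1) * (p + r) * (q + r)))"

lemma lam_initial:
  "lam a b c d 0 = 0" "lam a b c d 1 = 0" "lam a b c d 2 = a * b / (c * d)"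
  by (simp_all add: lam_def)

lemma lam_general:
  fixes a b c d :: real and n :: nat
  assumes "n \<ge> 1"
  defines "p \<equiv> cprime c d (int n)" and "q \<equiv> cprime c d (int n - 1)"
  shows "lam a b c d (3 * n) =
           real n * (b + real n - 1) * (p - a - 1)
           / ((p + real n - 2) * (p + real n - 1) * (q + real n - 1))"
    and "lam a b c d (3 * n + 1) =
           real n * (a + real n) * (q - b)
           / ((p + real n - 1) * (q + real n - 1) * (q + real n))"
    and "lam a b c d (3 * n + 2) =
           (a + real n) * (b + real n) * (p - 1)
           / ((p + real n - 1) * (p + real n) * (q + real n))"
proof -
  have "(3 * n) div 3 = n" "(3 * n + 1) div 3 = n" "(3 * n + 2) div 3 = n"
    "(3 * n) mod 3 = 0" "(3 * n + 1) mod 3 = 1" "(3 * n + 2) mod 3 = 2"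
    by presburger+
  with assms show
    "lam a b c d (3 * n) =
       real n * (b + real n - 1) * (p - a - 1)
       / ((p + real n - 2) * (p + real n - 1) * (q + real n - 1))"
    "lam a b c d (3 * n + 1) =
       real n * (a + real n) * (q - b)
       / ((p + real n - 1) * (q + real n - 1) * (q + real n))"
    "lam a b c d (3 * n + 2) =
       (a + real n) * (b + real n) * (p - 1)
       / ((p + real n - 1) * (p + real n) * (q + real n))"
    unfolding lam_def Let_def by simp_all
qed

definition beta_coeff :: "real \<Rightarrow> real \<Rightarrow> real \<Rightarrow> real \<Rightarrow> nat \<Rightarrow> real" where
  "beta_coeff a b c d n =
     lam a b c d (3 * n) + lam a b c d (3 * n + 1) + lam a b c d (3 * n + 2)"

(* The values alpha_0 and gamma_0 are arbitrary: in the recurrence they multiply zero polynomials. *)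
primrec alpha_coeff :: "real \<Rightarrow> real \<Rightarrow> real \<Rightarrow> real \<Rightarrow> nat \<Rightarrow> real" where
  "alpha_coeff a b c d 0 = 0"
| "alpha_coeff a b c d (Suc n) =
     lam a b c d (3 * n + 1) * lam a b c d (3 * n + 3)
     + lam a b c d (3 * n + 2) * lam a b c d (3 * n + 3)
     + lam a b c d (3 * n + 2) * lam a b c d (3 * n + 4)"

primrec gamma_coeff :: "real \<Rightarrow> real \<Rightarrow> real \<Rightarrow> real \<Rightarrow> nat \<Rightarrow> real" where
  "gamma_coeff a b c d 0 = 0"
| "gamma_coeff a b c d (Suc n) =
     lam a b c d (3 * n + 2) * lam a b c d (3 * n + 4) * lam a b c d (3 * n + 6)"

end

theory Submission
  imports Defs "HOL-Real_Asymp.Real_Asymp"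
begin

text \<open>Integrating the Gauss series of the weight termwise against Beta densities expresses its
  moments through Gauss series at \<open>1\<close>, and a telescoping contiguous relation for the latter gives the
  ratio of consecutive moments, so that up to a constant the \<open>n\<close>-th moment is
  \<open>(a)\<^sub>n (b)\<^sub>n / ((c)\<^sub>n (d)\<^sub>n)\<close>. Integrating \<open>x\<^sup>k\<close> times the monic multiple of
  \<open>\<^sub>3F\<^sub>2(-n, c'\<^bsub>n-1\<^esub>, c'\<^bsub>n-2\<^esub>; a, b; x)\<close> then amounts to taking an \<open>n\<close>-th finite difference of a polynomial
  of degree \<open>n - 1\<close>, which vanishes; by uniqueness these are the \<open>P\<^sub>n\<close>. Two contiguous
  relations of these polynomials factor the recurrence into three bidiagonal steps with entries
  \<open>\<lambda>\<^sub>m\<close>.\<close>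

section \<open>Gauss series at unit argument\<close>

text \<open>The same numbers serve as power series coefficients of the weight and, taken without a
  power, as the terms of the Gauss series at argument 1.\<close>

definition gauss_term :: "real \<Rightarrow> real \<Rightarrow> real \<Rightarrow> nat \<Rightarrow> real" where
  "gauss_term \<alpha> \<beta> \<gamma> n = pochhammer \<alpha> n * pochhammer \<beta> n / (pochhammer \<gamma> n * fact n)"

lemma gauss_term_Suc:
  "gauss_term \<alpha> \<beta> \<gamma> (Suc n) =
     gauss_term \<alpha> \<beta> \<gamma> n * ((\<alpha> + real n) * (\<beta> + real n) / ((\<gamma> + real n) * real (Suc n)))"
  by (simp add: gauss_term_def pochhammer_Suc mult_ac)

text \<open>Each Pochhammer symbol of length \<open>n + 1\<close> is a term of
  \<open>rGamma_series\<close> up to a power of \<open>n\<close> and \<open>fact n\<close>. One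
  factor \<open>fact n\<close> survives in the denominator where \<open>gauss_term\<close> has
  \<open>fact (Suc n)\<close>, hence the factor \<open>Suc n\<close>. So the terms decay like
  \<open>n\<close> to the power \<alpha> + \<beta> - \<gamma> - 1.\<close>

lemma gauss_term_asymp:
  assumes "\<gamma> > 0"
  shows "(\<lambda>n. real (Suc n) * gauss_term \<alpha> \<beta> \<gamma> (Suc n) * real n powr (\<gamma> - \<alpha> - \<beta>))
           \<longlonglongrightarrow> rGamma \<alpha> * rGamma \<beta> / rGamma \<gamma>"
proof (rule Lim_transform_eventually)
  have "\<gamma> \<notin> \<int>\<^sub>\<le>\<^sub>0"
    using assms by (auto dest: nonpos_Ints_nonpos)
  then have "rGamma \<gamma> \<noteq> 0"
    by (simp add: rGamma_eq_zero_iff)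
  then show "(\<lambda>n. rGamma_series \<alpha> n * rGamma_series \<beta> n / rGamma_series \<gamma> n)
          \<longlonglongrightarrow> rGamma \<alpha> * rGamma \<beta> / rGamma \<gamma>"
    by (intro tendsto_intros)
  show "\<forall>\<^sub>F n in sequentially. rGamma_series \<alpha> n * rGamma_series \<beta> n / rGamma_series \<gamma> n
          = real (Suc n) * gauss_term \<alpha> \<beta> \<gamma> (Suc n) * real n powr (\<gamma> - \<alpha> - \<beta>)"
    using eventually_gt_at_top[of 0]
  proof eventually_elim
    case (elim n)
    have "pochhammer \<gamma> (Suc n) > 0"
      using assms by (rule pochhammer_pos)
    moreover have "real n powr (\<gamma> - \<alpha> - \<beta>)
        = exp (\<gamma> * ln (real n)) / (exp (\<alpha> * ln (real n)) * exp (\<beta> * ln (real n)))"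
      using elim by (simp add: powr_def left_diff_distrib exp_diff)
    ultimately show ?case
      by (simp add: rGamma_series_def gauss_term_def field_simps del: of_nat_Suc)
  qed
qed

text \<open>This is the vanishing boundary term of the telescoping sum in
  \<open>gauss_contiguous\<close>.\<close>

lemma gauss_term_tendsto_0:
  assumes "\<gamma> > 0" "\<gamma> > \<alpha> + \<beta>"
  shows "(\<lambda>n. real n * gauss_term \<alpha> \<beta> \<gamma> n) \<longlonglongrightarrow> 0"
proof -
  have "(\<lambda>n. real n powr (- (\<gamma> - \<alpha> - \<beta>))) \<longlonglongrightarrow> 0"
    using assms by (intro tendsto_neg_powr filterlim_real_sequentially) auto
  from tendsto_mult[OF gauss_term_asymp[OF assms(1), of \<alpha> \<beta>] this]
  have "(\<lambda>n. real (Suc n) * gauss_term \<alpha> \<beta> \<gamma> (Suc n) * real n powr (\<gamma> - \<alpha> - \<beta>)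
           * real n powr (- (\<gamma> - \<alpha> - \<beta>))) \<longlonglongrightarrow> 0"
    by (simp only: mult_zero_right)
  moreover have "\<forall>\<^sub>F n in sequentially.
      real (Suc n) * gauss_term \<alpha> \<beta> \<gamma> (Suc n) * real n powr (\<gamma> - \<alpha> - \<beta>)
           * real n powr (- (\<gamma> - \<alpha> - \<beta>)) = real (Suc n) * gauss_term \<alpha> \<beta> \<gamma> (Suc n)"
    using eventually_gt_at_top[of 0]
    by eventually_elim (simp add: powr_add[symmetric] mult.assoc del: of_nat_Suc)
  ultimately have "(\<lambda>n. real (Suc n) * gauss_term \<alpha> \<beta> \<gamma> (Suc n)) \<longlonglongrightarrow> 0"
    by (rule Lim_transform_eventually)
  then show ?thesis
    by (rule LIMSEQ_imp_Suc)
qed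

text \<open>Comparison with a convergent p-series, by the decay rate above. Absolute convergence is
  what later permits exchanging sum and integral.\<close>

lemma summable_abs_gauss_term:
  assumes "\<gamma> > 0" "\<gamma> > \<alpha> + \<beta>"
  shows "summable (\<lambda>n. \<bar>gauss_term \<alpha> \<beta> \<gamma> n\<bar>)"
proof -
  have "Bseq (\<lambda>n. real (Suc n) * gauss_term \<alpha> \<beta> \<gamma> (Suc n) * real n powr (\<gamma> - \<alpha> - \<beta>))"
    using gauss_term_asymp[OF assms(1)] by (blast intro: convergent_imp_Bseq convergentI)
  then obtain K where
    K: "\<And>n. \<bar>real (Suc n) * gauss_term \<alpha> \<beta> \<gamma> (Suc n) * real n powr (\<gamma> - \<alpha> - \<beta>)\<bar> \<le> K"
    by (elim BseqE) (metis real_norm_def)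
  have "summable (\<lambda>n. K * real n powr (- (\<gamma> - \<alpha> - \<beta>) - 1))"
    using assms by (intro summable_mult) (simp add: summable_real_powr_iff)
  then have "summable (\<lambda>n. \<bar>gauss_term \<alpha> \<beta> \<gamma> (Suc n)\<bar>)"
  proof (rule summable_comparison_test_ev[rotated])
    show "\<forall>\<^sub>F n in sequentially. norm \<bar>gauss_term \<alpha> \<beta> \<gamma> (Suc n)\<bar>
            \<le> K * real n powr (- (\<gamma> - \<alpha> - \<beta>) - 1)"
      using eventually_gt_at_top[of 0]
    proof eventually_elim
      case (elim n)
      let ?p = "real n powr (\<gamma> - \<alpha> - \<beta>)"
      have "real n * ?p * \<bar>gauss_term \<alpha> \<beta> \<gamma> (Suc n)\<bar>
          \<le> real (Suc n) * ?p * \<bar>gauss_term \<alpha> \<beta> \<gamma> (Suc n)\<bar>"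
        by (intro mult_right_mono) auto
      also have "\<dots> \<le> K"
        using K[of n] by (simp add: abs_mult mult_ac)
      finally have "\<bar>gauss_term \<alpha> \<beta> \<gamma> (Suc n)\<bar> \<le> K / (real n * ?p)"
        using elim by (simp add: field_simps)
      also have "\<dots> = K * real n powr (- (\<gamma> - \<alpha> - \<beta>) - 1)"
        using elim by (simp add: powr_diff powr_minus divide_simps)
      finally show ?case by simp
    qed
  qed
  then show ?thesis
    by (subst (asm) summable_Suc_iff)
qed

text \<open>The difference of the two sides telescopes termwise to \<open>\<gamma> n t\<^sub>n\<close>, where \<open>t\<^sub>n\<close> are the
  terms of the left-hand series.\<close>
lemma gauss_contiguous:
  assumes "\<gamma> > 0" "\<gamma> > \<alpha> + \<beta>"
  shows "\<gamma> * (\<gamma> - \<alpha> - \<beta>) * (\<Sum>n. gauss_term \<alpha> \<beta> \<gamma> n)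
       = (\<gamma> - \<alpha>) * (\<gamma> - \<beta>) * (\<Sum>n. gauss_term \<alpha> \<beta> (\<gamma> + 1) n)"
proof -
  let ?t = "gauss_term \<alpha> \<beta> \<gamma>" and ?u = "gauss_term \<alpha> \<beta> (\<gamma> + 1)"
  have sum_t: "summable ?t" and sum_u: "summable ?u"
    using summable_abs_gauss_term[OF assms] summable_abs_gauss_term[of "\<gamma> + 1" \<alpha> \<beta>] assms
    by (auto intro: summable_rabs_cancel)
  have u: "?u n = ?t n * \<gamma> / (\<gamma> + real n)" for n
  proof -
    have "pochhammer \<gamma> n * (\<gamma> + real n) = \<gamma> * pochhammer (\<gamma> + 1) n"
      by (metis pochhammer_Suc pochhammer_rec)
    moreover have "pochhammer (\<gamma> + 1) n > 0" "pochhammer \<gamma> n > 0"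
      using assms by (auto intro: pochhammer_pos)
    ultimately show ?thesis
      using assms by (simp add: gauss_term_def field_simps)
  qed
  have telescope: "\<gamma> * (\<gamma> - \<alpha> - \<beta>) * ?t n - (\<gamma> - \<alpha>) * (\<gamma> - \<beta>) * ?u n
      = \<gamma> * (real n * ?t n) - \<gamma> * (real (Suc n) * ?t (Suc n))" for n
    using assms unfolding u gauss_term_Suc
    by (simp add: divide_simps del: of_nat_Suc) algebra
  have "(\<lambda>n. \<gamma> * (real n * ?t n)) \<longlonglongrightarrow> \<gamma> * 0"
    by (intro tendsto_mult tendsto_const gauss_term_tendsto_0 assms)
  then have "(\<lambda>n. \<gamma> * (real n * ?t n) - \<gamma> * (real (Suc n) * ?t (Suc n))) sums 0"
    using telescope_sums'[of "\<lambda>n. \<gamma> * (real n * ?t n)" 0] by simp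
  then have "(\<lambda>n. \<gamma> * (\<gamma> - \<alpha> - \<beta>) * ?t n - (\<gamma> - \<alpha>) * (\<gamma> - \<beta>) * ?u n) sums 0"
    by (simp only: telescope)
  moreover have "(\<lambda>n. \<gamma> * (\<gamma> - \<alpha> - \<beta>) * ?t n - (\<gamma> - \<alpha>) * (\<gamma> - \<beta>) * ?u n) sums
      (\<gamma> * (\<gamma> - \<alpha> - \<beta>) * suminf ?t - (\<gamma> - \<alpha>) * (\<gamma> - \<beta>) * suminf ?u)"
    by (intro sums_diff sums_mult summable_sums sum_t sum_u)
  ultimately show ?thesis
    using sums_unique2 by fastforce
qed

text \<open>The quotient of consecutive terms tends to \<open>z\<close>, so the midpoint of
  \<open>z\<close> and 1 eventually bounds it in the ratio test.\<close>

lemma summable_gauss_term_power: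
  assumes "\<gamma> > 0" "0 < z" "z < 1"
  shows "summable (\<lambda>n. \<bar>gauss_term \<alpha> \<beta> \<gamma> n\<bar> * z ^ n)"
proof -
  have "(\<lambda>n. (\<alpha> + real n) * (\<beta> + real n) / ((\<gamma> + real n) * real (Suc n))) \<longlonglongrightarrow> 1"
    by real_asymp
  then have "(\<lambda>n. \<bar>(\<alpha> + real n) * (\<beta> + real n) / ((\<gamma> + real n) * real (Suc n))\<bar> * z) \<longlonglongrightarrow> \<bar>1\<bar> * z"
    by (intro tendsto_intros)
  moreover have "\<bar>1\<bar> * z < (1 + z) / 2"
    using assms by simp
  ultimately have "\<forall>\<^sub>F n in sequentially.
      \<bar>(\<alpha> + real n) * (\<beta> + real n) / ((\<gamma> + real n) * real (Suc n))\<bar> * z < (1 + z) / 2"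
    by (rule order_tendstoD)
  then obtain N where N: "\<And>n. n \<ge> N \<Longrightarrow>
      \<bar>(\<alpha> + real n) * (\<beta> + real n) / ((\<gamma> + real n) * real (Suc n))\<bar> * z \<le> (1 + z) / 2"
    unfolding eventually_sequentially by (meson less_imp_le)
  show ?thesis
  proof (rule summable_ratio_test)
    show "(1 + z) / 2 < 1"
      using assms by simp
    fix n assume "n \<ge> N"
    from mult_right_mono[OF N[OF this], of "\<bar>gauss_term \<alpha> \<beta> \<gamma> n\<bar> * z ^ n"]
    show "norm (\<bar>gauss_term \<alpha> \<beta> \<gamma> (Suc n)\<bar> * z ^ Suc n)
        \<le> (1 + z) / 2 * norm (\<bar>gauss_term \<alpha> \<beta> \<gamma> n\<bar> * z ^ n)"
      using assms unfolding gauss_term_Suc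
      by (simp add: abs_mult mult_ac del: of_nat_Suc)
  qed
qed

section \<open>Moments of the weights\<close>

text \<open>The library integral is a gauge integral over the closed interval. Nonnegativity makes
  it absolute, and Borel measurability brings it from the completed measure down to
  \<open>lborel\<close>.\<close>

lemma set_integrable_Beta:
  fixes a b :: real
  assumes "a > 0" "b > 0"
  shows "set_integrable lborel {0<..<1} (\<lambda>x. x powr (a - 1) * (1 - x) powr (b - 1))"
    and "(LBINT x:{0<..<1}. x powr (a - 1) * (1 - x) powr (b - 1)) = Beta a b"
proof -
  let ?f = "\<lambda>x. x powr (a - 1) * (1 - x) powr (b - 1)"
  have I: "(?f has_integral Beta a b) {0<..<1}"
    using has_integral_Beta_real[OF assms] by (simp add: has_integral_Icc_iff_Ioo)
  have "?f absolutely_integrable_on {0<..<1}"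
    using I by (intro nonnegative_absolutely_integrable_1) auto
  then show S: "set_integrable lborel {0<..<1} ?f"
    unfolding set_integrable_def by (subst (asm) integrable_completion) auto
  show "(LBINT x:{0<..<1}. ?f x) = Beta a b"
    using set_borel_integral_eq_integral(2)[OF S] I by (simp add: integral_unique)
qed

text \<open>The factor \<open>Gamma (\<delta> + n)\<close> of the Beta value cancels against the
  lower Pochhammer symbol, and \<open>Gamma (s + \<delta> + n)\<close> takes its place. Integration
  thus replaces the lower parameter \<delta> by s + \<delta>.\<close>

lemma gauss_term_Beta:
  assumes "s > 0" "\<delta> > 0"
  shows "gauss_term \<alpha> \<beta> \<delta> n * Beta s (\<delta> + real n) = Beta s \<delta> * gauss_term \<alpha> \<beta> (s + \<delta>) n"
proof -
  have "pochhammer \<delta> n = Gamma (\<delta> + real n) / Gamma \<delta>"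
       "pochhammer (s + \<delta>) n = Gamma (s + \<delta> + real n) / Gamma (s + \<delta>)"
    using assms by (auto intro!: pochhammer_Gamma dest: nonpos_Ints_nonpos)
  moreover have "pochhammer \<delta> n > 0" "pochhammer (s + \<delta>) n > 0"
    using assms by (auto intro: pochhammer_pos)
  moreover have "Gamma \<delta> > 0" "Gamma (s + \<delta>) > 0" "Gamma (\<delta> + real n) > 0"
      "Gamma (s + \<delta> + real n) > 0"
    using assms by (auto intro!: Gamma_real_pos)
  ultimately show ?thesis
    by (simp add: gauss_term_def Beta_def add.assoc field_simps)
qed

lemma hypergeom_2F1_eq: "hypergeom_2F1 \<alpha> \<beta> \<gamma> z = (\<Sum>n. gauss_term \<alpha> \<beta> \<gamma> n * z ^ n)"
  by (simp add: hypergeom_2F1_def gauss_term_def)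

text \<open>Termwise integration of the Gauss series. The integrals of the absolute values are again
  Gauss terms, now at lower parameter s + \<delta>, and the third assumption makes them
  summable.\<close>

lemma Beta_hypergeom_integral:
  assumes "s > 0" "\<delta> > 0" "s + \<delta> > \<alpha> + \<beta>"
  defines "f \<equiv> (\<lambda>x. x powr (s - 1) * (1 - x) powr (\<delta> - 1) * hypergeom_2F1 \<alpha> \<beta> \<delta> (1 - x))"
  shows "set_integrable lborel {0<..<1} f"
    and "(LBINT x:{0<..<1}. f x) = Beta s \<delta> * (\<Sum>n. gauss_term \<alpha> \<beta> (s + \<delta>) n)"
proof -
  let ?t = "gauss_term \<alpha> \<beta> \<delta>"
  \<comment> \<open>The power \<open>(1 - x) ^ n\<close> is absorbed into the Beta density, and the
    indicator lets sums and integrals run over the whole line.\<close>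
  define b where "b = (\<lambda>n (x::real).
    indicator {0<..<1} x * (x powr (s - 1) * (1 - x) powr (\<delta> + real n - 1)))"
  have int_b: "integrable lborel (b n)" and lint_b: "integral\<^sup>L lborel (b n) = Beta s (\<delta> + real n)" for n
    using set_integrable_Beta[of s "\<delta> + real n"] assms
    by (simp_all add: b_def set_integrable_def set_lebesgue_integral_def)
  have b_nonneg: "b n x \<ge> 0" for n x
    by (simp add: b_def)
  have b_eq: "b n x = indicator {0<..<1} x * (x powr (s - 1) * (1 - x) powr (\<delta> - 1) * (1 - x) ^ n)" for n x
    by (cases "x \<in> {0<..<1}") (simp_all add: b_def powr_add powr_diff powr_realpow)
  have sum_tb: "summable (\<lambda>n. norm (?t n * b n x))" for x
  proof (cases "x \<in> {0<..<1}")
    case True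
    have "summable (\<lambda>n. x powr (s - 1) * (1 - x) powr (\<delta> - 1) * (\<bar>?t n\<bar> * (1 - x) ^ n))"
      using True assms by (intro summable_mult summable_gauss_term_power) auto
    then show ?thesis
      using True by (simp add: b_eq abs_mult mult_ac)
  qed (simp add: b_def)
  have "summable (\<lambda>n. Beta s \<delta> * \<bar>gauss_term \<alpha> \<beta> (s + \<delta>) n\<bar>)"
    using assms by (intro summable_mult summable_abs_gauss_term) auto
  moreover have "(\<integral>x. norm (?t n * b n x) \<partial>lborel) = Beta s \<delta> * \<bar>gauss_term \<alpha> \<beta> (s + \<delta>) n\<bar>" for n
  proof -
    have "Beta s (\<delta> + real n) \<ge> 0" "Beta s \<delta> \<ge> 0"
      using assms by (simp_all add: Beta_def Gamma_real_nonneg)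
    then show ?thesis
      using gauss_term_Beta[OF assms(1,2), of \<alpha> \<beta> n, THEN arg_cong[where f = abs]]
      by (simp add: abs_mult b_nonneg lint_b)
  qed
  ultimately have sum_int: "summable (\<lambda>n. \<integral>x. norm (?t n * b n x) \<partial>lborel)"
    by simp
  have f_eq: "indicator {0<..<1} x *\<^sub>R f x = (\<Sum>n. ?t n * b n x)" for x
  proof (cases "x \<in> {0<..<1}")
    case True
    have "summable (\<lambda>n. ?t n * (1 - x) ^ n)"
      using summable_gauss_term_power[of \<delta> "1 - x" \<alpha> \<beta>] True assms
      by (auto intro: summable_rabs_cancel simp: abs_mult)
    from suminf_mult[OF this, of "x powr (s - 1) * (1 - x) powr (\<delta> - 1)"]
    show ?thesis
      using True by (simp add: b_eq f_def hypergeom_2F1_eq mult_ac)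
  qed (simp add: b_def)
  have int_tb: "integrable lborel (\<lambda>x. ?t n * b n x)" for n
    using int_b by simp
  note * = int_tb AE_I2[OF sum_tb] sum_int
  show "set_integrable lborel {0<..<1} f"
    unfolding set_integrable_def f_eq by (rule integrable_suminf[OF *])
  have "(LBINT x:{0<..<1}. f x) = (\<Sum>n. \<integral>x. ?t n * b n x \<partial>lborel)"
    unfolding set_lebesgue_integral_def f_eq by (rule integral_suminf[OF *])
  also have "\<dots> = (\<Sum>n. Beta s \<delta> * gauss_term \<alpha> \<beta> (s + \<delta>) n)"
    using assms by (simp add: lint_b gauss_term_Beta)
  also have "\<dots> = Beta s \<delta> * (\<Sum>n. gauss_term \<alpha> \<beta> (s + \<delta>) n)"
    using assms by (intro suminf_mult summable_rabs_cancel[OF summable_abs_gauss_term]) auto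
  finally show "(LBINT x:{0<..<1}. f x) = Beta s \<delta> * (\<Sum>n. gauss_term \<alpha> \<beta> (s + \<delta>) n)" .
qed

text \<open>The factor \<open>x ^ k\<close> moves only the exponent of \<open>x\<close>; \<delta>
  and the hypergeometric parameters stay. Hence \<open>Beta_hypergeom_integral\<close> applies with
  s = a + k, and its convergence condition becomes b + k > 0.\<close>

lemma weight_W_power:
  assumes "0 < x"
  shows "x ^ k * weight_W a b c d x =
    Gamma c * Gamma d / (Gamma a * Gamma b * Gamma (c + d - a - b)) *
    (x powr (a + real k - 1) * (1 - x) powr (c + d - a - b - 1)
     * hypergeom_2F1 (c - b) (d - b) (c + d - a - b) (1 - x))"
proof -
  have "x powr (a + real k - 1) = x powr (a - 1) * x ^ k"
    using assms by (simp add: powr_add[symmetric] powr_realpow[symmetric] algebra_simps)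
  then show ?thesis
    by (simp add: weight_W_def Let_def)
qed

text \<open>The Beta factor and the Gauss series at 1 each have a rational ratio between
  \<open>k\<close> and \<open>k + 1\<close>. Their product gives a first-order recurrence for the
  moments, which is solved by induction; the constant is the zeroth moment.\<close>

lemma weight_W_moment:
  assumes "a > 0" "b > 0" "c > 0" "d > 0" "c + d > a + b"
  shows "set_integrable lborel {0<..<1} (\<lambda>x. x ^ k * weight_W a b c d x)"
    and "\<exists>\<mu>. \<forall>k. (LBINT x:{0<..<1}. x ^ k * weight_W a b c d x) =
           \<mu> * (pochhammer a k * pochhammer b k / (pochhammer c k * pochhammer d k))"
proof -
  define \<delta> where "\<delta> = c + d - a - b"
  define K where "K = Gamma c * Gamma d / (Gamma a * Gamma b * Gamma \<delta>)"
  define h where "h = (\<lambda>k x. x powr (a + real k - 1) * (1 - x) powr (\<delta> - 1)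
     * hypergeom_2F1 (c - b) (d - b) \<delta> (1 - x))"
  define S where "S k = (\<Sum>n. gauss_term (c - b) (d - b) (a + real k + \<delta>) n)" for k
  define m where "m k = (LBINT x:{0<..<1}. x ^ k * weight_W a b c d x)" for k
  have W: "x ^ k * weight_W a b c d x = K * h k x" if "x \<in> {0<..<1}" for x k
    using weight_W_power[of x k a b c d] that by (simp add: K_def h_def \<delta>_def)
  have h: "set_integrable lborel {0<..<1} (h k)"
    "(LBINT x:{0<..<1}. h k x) = Beta (a + real k) \<delta> * S k" for k
    unfolding h_def S_def using assms
    by (intro Beta_hypergeom_integral; simp add: \<delta>_def)+
  show "set_integrable lborel {0<..<1} (\<lambda>x. x ^ k * weight_W a b c d x)"
    using h(1)[of k] by (subst set_integrable_cong[OF refl refl W]) auto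
  have m: "m k = K * (Beta (a + real k) \<delta> * S k)" for k
    unfolding m_def using W by (subst set_lebesgue_integral_cong[where g = "\<lambda>x. K * h k x"]) (auto simp: h)
  have m_Suc: "(c + real k) * (d + real k) * m (Suc k) = (a + real k) * (b + real k) * m k" for k
  proof -
    \<comment> \<open>The lower parameter of the series \<open>S k\<close>. With upper parameters c
      - b and d - b, the differences in \<open>gauss_contiguous\<close> become b + k, d + k and c +
      k.\<close>
    define g where "g = a + real k + \<delta>"
    have "g > 0" "g > (c - b) + (d - b)"
      using assms by (auto simp: g_def \<delta>_def)
    from gauss_contiguous[OF this]
    have 1: "g * ((b + real k) * S k) = (c + real k) * (d + real k) * S (Suc k)"
      by (simp add: S_def g_def \<delta>_def algebra_simps)
    have "a + real k \<notin> \<int>\<^sub>\<le>\<^sub>0"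
      using assms by (auto dest: nonpos_Ints_nonpos)
    from Beta_plus1_left[OF this, of \<delta>]
    have 2: "g * Beta (a + real (Suc k)) \<delta> = (a + real k) * Beta (a + real k) \<delta>"
      by (simp add: g_def add_ac)
    have "g * ((c + real k) * (d + real k) * m (Suc k))
        = K * (g * Beta (a + real (Suc k)) \<delta>) * ((c + real k) * (d + real k) * S (Suc k))"
      by (simp add: m mult_ac)
    also have "\<dots> = g * ((a + real k) * (b + real k) * m k)"
      unfolding 1[symmetric] 2 m by (simp add: mult_ac)
    finally show ?thesis
      using \<open>g > 0\<close> by simp
  qed
  have "m k = m 0 * (pochhammer a k * pochhammer b k / (pochhammer c k * pochhammer d k))" for k
  proof (induction k)
    case (Suc k)
    have "(c + real k) * (d + real k) \<noteq> 0" "pochhammer c k \<noteq> 0" "pochhammer d k \<noteq> 0"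
      using assms pochhammer_pos[of c k] pochhammer_pos[of d k] by auto
    moreover from this m_Suc[of k]
    have "m (Suc k) = (a + real k) * (b + real k) * m k / ((c + real k) * (d + real k))"
      by (simp add: field_simps)
    ultimately show ?case
      by (simp add: Suc.IH pochhammer_Suc mult_ac)
  qed simp
  then show "\<exists>\<mu>. \<forall>k. (LBINT x:{0<..<1}. x ^ k * weight_W a b c d x) =
           \<mu> * (pochhammer a k * pochhammer b k / (pochhammer c k * pochhammer d k))"
    unfolding m_def by blast
qed

section \<open>Hypergeometric polynomials and uniqueness\<close>

text \<open>The sum is an \<open>n\<close>-th finite difference up to sign. Pascal's rule turns the
  sum of order \<open>n + 1\<close> for \<open>f\<close> into the one of order \<open>n\<close> for
  the first difference of \<open>f\<close>, whose degree is smaller.\<close>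

lemma alternating_binomial_poly_sum:
  fixes f :: "real poly"
  assumes "f = 0 \<or> degree f < n"
  shows "(\<Sum>i\<le>n. (- 1) ^ i * real (n choose i) * poly f (real i)) = 0"
  using assms
proof (induction n arbitrary: f)
  case (Suc n)
  define g where "g = f - pcompose f [:1, 1:]"
  have "degree g \<le> degree f"
    unfolding g_def by (intro degree_diff_le) (simp_all add: degree_pcompose)
  moreover have "coeff g (degree f) = 0"
    using lead_coeff_comp[of "[:1, 1:]" f] by (simp add: g_def degree_pcompose)
  ultimately have "g = 0 \<or> degree g < degree f"
    by (rule eq_zero_or_degree_less)
  then have "g = 0 \<or> degree g < n"
    using Suc.prems by (auto simp: g_def)
  then have "(\<Sum>i\<le>n. (- 1) ^ i * real (n choose i) * poly g (real i)) = 0"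
    by (rule Suc.IH)
  moreover have "(\<Sum>i\<le>Suc n. (- 1) ^ i * real (Suc n choose i) * poly f (real i))
      = (\<Sum>i\<le>n. (- 1) ^ i * real (n choose i) * poly g (real i))"
  proof -
    let ?h = "\<lambda>i. (- 1) ^ i * real (n choose i) * poly f (real i)"
    have "(\<Sum>i\<le>Suc n. (- 1) ^ i * real (Suc n choose i) * poly f (real i))
        = (?h 0 + (\<Sum>i\<le>n. ?h (Suc i)))
          - (\<Sum>i\<le>n. (- 1) ^ i * real (n choose i) * poly f (real (Suc i)))"
      by (subst sum.atMost_Suc_shift)
         (simp add: sum.distrib sum_subtractf sum_negf ring_distribs add_ac)
    also have "?h 0 + (\<Sum>i\<le>n. ?h (Suc i)) = (\<Sum>i\<le>Suc n. ?h i)"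
      by (rule sum.atMost_Suc_shift[symmetric])
    finally show ?thesis
      by (simp add: g_def poly_pcompose right_diff_distrib sum_subtractf add.commute)
  qed
  ultimately show ?case
    by simp
qed simp

lemma poly_pochhammer_shift:
  obtains f :: "real poly" where "degree f = k" "\<And>x. poly f x = pochhammer (s + x) k"
proof
  show "degree (\<Prod>j<k. [:s + real j, 1:]) = k"
    by (subst degree_prod_eq_sum_degree) auto
  show "poly (\<Prod>j<k. [:s + real j, 1:]) x = pochhammer (s + x) k" for x
    by (simp add: poly_prod pochhammer_prod lessThan_atLeast0 add_ac)
qed

lemma alternating_binomial_pochhammer_sum:
  assumes "k1 + k2 + k3 + k4 < n"
  shows "(\<Sum>i\<le>n. (- 1) ^ i * real (n choose i) *
     (pochhammer (s1 + real i) k1 * pochhammer (s2 + real i) k2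
      * (pochhammer (s3 + real i) k3 * pochhammer (s4 + real i) k4))) = 0"
proof -
  obtain f1 where f1: "degree f1 = k1" "\<And>x. poly f1 x = pochhammer (s1 + x) k1"
    using poly_pochhammer_shift by blast
  obtain f2 where f2: "degree f2 = k2" "\<And>x. poly f2 x = pochhammer (s2 + x) k2"
    using poly_pochhammer_shift by blast
  obtain f3 where f3: "degree f3 = k3" "\<And>x. poly f3 x = pochhammer (s3 + x) k3"
    using poly_pochhammer_shift by blast
  obtain f4 where f4: "degree f4 = k4" "\<And>x. poly f4 x = pochhammer (s4 + x) k4"
    using poly_pochhammer_shift by blast
  have "degree (f1 * f2 * (f3 * f4)) < n"
    using assms degree_mult_le[of f1 f2] degree_mult_le[of f3 f4] degree_mult_le[of "f1 * f2" "f3 * f4"]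
    unfolding f1 f2 f3 f4 by linarith
  then show ?thesis
    using alternating_binomial_poly_sum[of "f1 * f2 * (f3 * f4)" n] by (simp add: f1 f2 f3 f4)
qed

text \<open>Here \<open>(- 1) ^ i * (n choose i)\<close> is the Pochhammer symbol of -n divided by
  \<open>fact i\<close>. The remaining prefactor normalises the coefficient at \<open>i = n\<close>
  to 1.\<close>

definition hyp_coeff :: "nat \<Rightarrow> real \<Rightarrow> real \<Rightarrow> real \<Rightarrow> real \<Rightarrow> nat \<Rightarrow> real" where
  "hyp_coeff n a b p q i = (- 1) ^ (n + i) * real (n choose i)
     * (pochhammer a n * pochhammer b n / (pochhammer p n * pochhammer q n))
     * (pochhammer p i * pochhammer q i / (pochhammer a i * pochhammer b i))"

text \<open>The monic polynomial proportional to \<open>\<^sub>3F\<^sub>2(-n, p, q; a, b; x)\<close>.\<close>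
definition hyp_poly :: "nat \<Rightarrow> real \<Rightarrow> real \<Rightarrow> real \<Rightarrow> real \<Rightarrow> real poly" where
  "hyp_poly n a b p q = (\<Sum>i\<le>n. monom (hyp_coeff n a b p q i) i)"

lemma coeff_hyp_poly [simp]: "coeff (hyp_poly n a b p q) i = hyp_coeff n a b p q i"
  by (simp add: hyp_poly_def coeff_sum hyp_coeff_def)

lemma hyp_poly_commute: "hyp_poly n b a p q = hyp_poly n a b p q" "hyp_poly n a b q p = hyp_poly n a b p q"
  by (simp_all add: poly_eq_iff hyp_coeff_def mult_ac)

lemma hyp_poly_0 [simp]: "hyp_poly 0 a b p q = 1"
  by (simp add: hyp_poly_def hyp_coeff_def)

lemma hyp_poly_monic:
  assumes "a > 0" "b > 0" "n > 0 \<Longrightarrow> p > 0" "n > 0 \<Longrightarrow> q > 0"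
  shows "degree (hyp_poly n a b p q) = n" "lead_coeff (hyp_poly n a b p q) = 1"
proof -
  have "pochhammer a n > 0" "pochhammer b n > 0" "pochhammer p n > 0" "pochhammer q n > 0"
    using assms by (cases n; auto intro: pochhammer_pos)+
  then have 1: "hyp_coeff n a b p q n = 1"
    by (simp add: hyp_coeff_def)
  show deg: "degree (hyp_poly n a b p q) = n"
  proof (rule antisym)
    show "degree (hyp_poly n a b p q) \<le> n"
      by (rule degree_le) (simp add: hyp_coeff_def)
    show "degree (hyp_poly n a b p q) \<ge> n"
      by (rule le_degree) (simp add: 1)
  qed
  show "lead_coeff (hyp_poly n a b p q) = 1"
    by (simp add: deg 1)
qed

text \<open>After cancellation each quotient of Pochhammer symbols is, up to a constant, a
  polynomial in \<open>i\<close>. The degrees k1, k2, m - k2 and l - k1 add up to m + l, which is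
  below \<open>n\<close>.\<close>

lemma hyp_coeff_orthogonal:
  assumes "a > 0" "b > 0" "c > 0" "d > 0" "k1 \<le> l" "k2 \<le> m" "m + l < n"
  shows "(\<Sum>i\<le>n. hyp_coeff n a b (c + real m) (d + real l) i *
     (pochhammer a (i + k1) * pochhammer b (i + k2) / (pochhammer c (i + k2) * pochhammer d (i + k1)))) = 0"
proof -
  define K where "K = (- 1) ^ n
    * (pochhammer a n * pochhammer b n / (pochhammer (c + real m) n * pochhammer (d + real l) n))
    / (pochhammer c m * pochhammer d l)"
  have pos: "pochhammer a i > 0" "pochhammer b i > 0" "pochhammer c i > 0" "pochhammer d i > 0" for i
    using assms by (auto intro: pochhammer_pos)
  \<comment> \<open>The cross-multiplied form splits \<open>pochhammer s (r + i)\<close> in two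
    ways, after \<open>r\<close> and after \<open>i + k\<close> factors.\<close>
  have shift: "pochhammer (s + real r) i / pochhammer s (i + k)
      = pochhammer (s + real k + real i) (r - k) / pochhammer s r" if "s > 0" "k \<le> r" for s r k i
  proof -
    have "pochhammer s r * pochhammer (s + real r) i = pochhammer s ((i + k) + (r - k))"
      using that by (simp add: pochhammer_product'[symmetric] add.commute)
    also have "\<dots> = pochhammer s (i + k) * pochhammer (s + real k + real i) (r - k)"
      by (subst pochhammer_product') (simp add: add_ac)
    finally have "pochhammer s r * pochhammer (s + real r) i
        = pochhammer s (i + k) * pochhammer (s + real k + real i) (r - k)" .
    moreover have "pochhammer s r > 0" "pochhammer s (i + k) > 0"
      using that by (auto intro: pochhammer_pos)
    ultimately show ?thesis
      by (simp add: field_simps)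
  qed
  have "hyp_coeff n a b (c + real m) (d + real l) i *
     (pochhammer a (i + k1) * pochhammer b (i + k2) / (pochhammer c (i + k2) * pochhammer d (i + k1)))
    = K * ((- 1) ^ i * real (n choose i) *
     (pochhammer (a + real i) k1 * pochhammer (b + real i) k2
      * (pochhammer (c + real k2 + real i) (m - k2) * pochhammer (d + real k1 + real i) (l - k1))))" for i
  proof -
    have "hyp_coeff n a b (c + real m) (d + real l) i *
     (pochhammer a (i + k1) * pochhammer b (i + k2) / (pochhammer c (i + k2) * pochhammer d (i + k1)))
    = (- 1) ^ n
    * (pochhammer a n * pochhammer b n / (pochhammer (c + real m) n * pochhammer (d + real l) n))
    * ((- 1) ^ i * real (n choose i) *
     (pochhammer a (i + k1) / pochhammer a i * (pochhammer b (i + k2) / pochhammer b i)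
      * ((pochhammer (c + real m) i / pochhammer c (i + k2)) * (pochhammer (d + real l) i / pochhammer d (i + k1)))))"
      by (simp add: hyp_coeff_def power_add mult_ac)
    also have "pochhammer a (i + k1) / pochhammer a i = pochhammer (a + real i) k1"
      using pos(1)[of i] by (simp add: pochhammer_product')
    also have "pochhammer b (i + k2) / pochhammer b i = pochhammer (b + real i) k2"
      using pos(2)[of i] by (simp add: pochhammer_product')
    also have "pochhammer (c + real m) i / pochhammer c (i + k2)
        = pochhammer (c + real k2 + real i) (m - k2) / pochhammer c m"
      using assms by (intro shift)
    also have "pochhammer (d + real l) i / pochhammer d (i + k1)
        = pochhammer (d + real k1 + real i) (l - k1) / pochhammer d l"
      using assms by (intro shift)
    finally show ?thesis
      by (simp add: K_def)
  qed
  then show ?thesis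
    using assms alternating_binomial_pochhammer_sum[of k1 k2 "m - k2" "l - k1" n]
    by (simp add: sum_distrib_left[symmetric])
qed

section \<open>Uniqueness from a triangular system of functionals\<close>

lemma poly_weight_integral:
  fixes w :: "real \<Rightarrow> real"
  assumes "\<And>k. set_integrable lborel S (\<lambda>x. x ^ k * w x)"
  shows "set_integrable lborel S (\<lambda>x. poly p x * w x)"
    and "(LBINT x:S. poly p x * w x) = (\<Sum>i\<le>degree p. coeff p i * (LBINT x:S. x ^ i * w x))"
proof -
  have eq: "indicator S x *\<^sub>R (poly p x * w x)
      = (\<Sum>i\<le>degree p. coeff p i * (indicator S x *\<^sub>R (x ^ i * w x)))" for x
    by (simp add: poly_altdef sum_distrib_left sum_distrib_right mult_ac)
  have int: "integrable lborel (\<lambda>x. coeff p i * (indicator S x *\<^sub>R (x ^ i * w x)))" for i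
    using assms[of i] unfolding set_integrable_def by simp
  show "set_integrable lborel S (\<lambda>x. poly p x * w x)"
    unfolding set_integrable_def eq by (intro Bochner_Integration.integrable_sum int)
  show "(LBINT x:S. poly p x * w x) = (\<Sum>i\<le>degree p. coeff p i * (LBINT x:S. x ^ i * w x))"
    unfolding set_lebesgue_integral_def eq
    by (subst Bochner_Integration.integral_sum) (use int in simp_all)
qed

text \<open>Subtracting the right multiple of \<open>P n\<close> lowers the degree, and the
  functionals of index below \<open>n\<close> still vanish on the remainder. By induction
  \<open>R\<close> is a multiple of \<open>P n\<close>, and \<phi> n forces that multiple to be
  zero.\<close>

lemma biorthogonal_eq_0:
  fixes P :: "nat \<Rightarrow> 'a::field poly" and \<phi> :: "nat \<Rightarrow> 'a poly \<Rightarrow> 'a"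
  assumes linear: "\<And>i p q c. \<phi> i (p - smult c q) = \<phi> i p - c * \<phi> i q"
    and monic: "\<And>n. degree (P n) = n" "\<And>n. lead_coeff (P n) = 1"
    and orth: "\<And>i m. i < m \<Longrightarrow> \<phi> i (P m) = 0" "\<And>i. \<phi> i (P i) \<noteq> 0"
    and "R = 0 \<or> degree R < n" "\<And>i. i < n \<Longrightarrow> \<phi> i R = 0"
  shows "R = 0"
  using assms(6,7)
proof (induction n arbitrary: R)
  case (Suc n)
  define R' where "R' = R - smult (coeff R n) (P n)"
  have "degree R' \<le> n" "coeff R' n = 0"
    using Suc.prems(1) monic[of n] degree_smult_le[of "coeff R n" "P n"]
    by (auto simp: R'_def intro!: degree_diff_le)
  then have "R' = 0 \<or> degree R' < n"
    by (rule eq_zero_or_degree_less)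
  then have "R' = 0"
    by (rule Suc.IH) (use Suc.prems(2) orth(1) in \<open>simp add: R'_def linear\<close>)
  \<comment> \<open>Linearity is assumed only for p - c q; its instance with p = q = 0 and c = 1
    yields that \<phi> n vanishes at 0.\<close>
  moreover have "\<phi> n R' = - coeff R n * \<phi> n (P n)" "\<phi> n (0 - smult 1 0) = 0"
    using Suc.prems(2)[of n] by (simp_all only: R'_def linear) simp_all
  ultimately show ?case
    using orth(2)[of n] by (simp add: R'_def)
qed simp

section \<open>Contiguous relations\<close>

lemma pochhammer_plus_one:
  fixes s :: real
  assumes "s > 0"
  shows "pochhammer (s + 1) k = pochhammer s k * (s + real k) / s"
proof -
  have "s * pochhammer (s + 1) k = pochhammer s k * (s + real k)"
    by (metis pochhammer_Suc pochhammer_rec)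
  with assms show ?thesis
    by (simp add: field_simps)
qed

text \<open>Coefficients are compared over a common factor \<open>X\<close>. What is left is (a + n
  + 1)(q + i) - (q + n + 1)(a + i) = (q - a)(n + 1 - i).\<close>

lemma hyp_poly_shift_one:
  assumes "a > 0" "b > 0" "p > 0" "q > 0"
  shows "hyp_poly (Suc n) a b p q = hyp_poly (Suc n) (a + 1) b p (q + 1)
    + smult (real (Suc n) * (b + real n) * (q - a)
        / ((q + real n) * (q + real (Suc n)) * (p + real n))) (hyp_poly n (a + 1) b p q)"
proof (rule poly_eqI)
  fix i
  define N where "N = real (Suc n choose i)"
  \<comment> \<open>At i = n + 1 the second factor vanishes and beyond it the binomial does, so
    \<open>bin\<close> holds for every \<open>i\<close>.\<close>
  have "i > n \<Longrightarrow> N * (real (Suc n) - real i) = 0"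
    by (cases "i = Suc n") (simp_all add: N_def)
  moreover have "real (Suc n) * real (n choose i) = N * (real (Suc n) - real i)" if "i \<le> n"
  proof -
    have "real ((Suc n - i) * (Suc n choose i)) = real (Suc n * (n choose i))"
      using binomial_absorb_comp[of "Suc n" i] by (simp only: diff_Suc_1)
    with that show ?thesis
      by (simp add: N_def of_nat_diff mult.commute del: of_nat_Suc mult_Suc mult_Suc_right binomial_Suc_Suc)
  qed
  ultimately have bin: "real (n choose i) = N * (real (Suc n) - real i) / real (Suc n)"
    by (cases "i \<le> n") (auto simp: nonzero_eq_divide_eq mult.commute simp del: of_nat_Suc)
  have shift: "s + 1 + real k = s + real (Suc k)" for s k
    by simp
  define X where "X = (- 1) ^ (n + i) * N * (pochhammer a (Suc n) * pochhammer b n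
      / (pochhammer p n * pochhammer q n))
     * (pochhammer p i * pochhammer q i / (pochhammer a i * pochhammer b i))"
  have e1: "hyp_coeff (Suc n) a b p q i = - X * (b + real n) / ((p + real n) * (q + real n))"
    by (simp add: hyp_coeff_def X_def N_def[symmetric] pochhammer_Suc mult_ac)
  have e2: "hyp_coeff (Suc n) (a + 1) b p (q + 1) i
      = - X * (b + real n) * (a + real (Suc n)) * (q + real i)
          / ((p + real n) * (q + real n) * (q + real (Suc n)) * (a + real i))"
    using assms
    by (simp add: hyp_coeff_def X_def N_def[symmetric] pochhammer_plus_one pochhammer_Suc[of b]
        pochhammer_Suc[of p] pochhammer_Suc[of q] shift mult_ac del: of_nat_Suc)
  have e3: "hyp_coeff n (a + 1) b p q i = X * (real (Suc n) - real i) / (real (Suc n) * (a + real i))"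
    using assms
    by (simp add: hyp_coeff_def X_def bin pochhammer_plus_one pochhammer_Suc[of a] shift mult_ac del: of_nat_Suc)
  have nz: "a + real i > 0" "p + real n > 0" "q + real n > 0" "q + real (Suc n) > 0"
    using assms by auto
  show "coeff (hyp_poly (Suc n) a b p q) i = coeff (hyp_poly (Suc n) (a + 1) b p (q + 1)
    + smult (real (Suc n) * (b + real n) * (q - a)
        / ((q + real n) * (q + real (Suc n)) * (p + real n))) (hyp_poly n (a + 1) b p q)) i"
    unfolding coeff_add coeff_smult coeff_hyp_poly e1 e2 e3
    using nz by (simp add: divide_simps del: of_nat_Suc) (simp add: algebra_simps)
qed

text \<open>The left side has no constant term, which fixes the scalar on the right. The other
  coefficients reduce to (j + 1)(q + n + 1) = (n + 1)(q + j + 1) - q (n - j).\<close>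

lemma hyp_poly_shift_all:
  assumes "a > 0" "b > 0" "p > 0" "q > 0"
  shows "pCons 0 (hyp_poly n (a + 1) (b + 1) (p + 1) (q + 1)) = hyp_poly (Suc n) a b p (q + 1)
    + smult ((a + real n) * (b + real n) * q
        / ((q + real n) * (q + real (Suc n)) * (p + real n))) (hyp_poly n a b p q)"
proof (rule poly_eqI)
  fix i
  have pos': "a + real k > 0" "b + real k > 0" "p + real k > 0" "q + real k > 0" for k
    using assms by auto
  show "coeff (pCons 0 (hyp_poly n (a + 1) (b + 1) (p + 1) (q + 1))) i
    = coeff (hyp_poly (Suc n) a b p (q + 1) + smult ((a + real n) * (b + real n) * q
        / ((q + real n) * (q + real (Suc n)) * (p + real n))) (hyp_poly n a b p q)) i"
  proof (cases i)
    case 0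
    show ?thesis
      using assms pos'[of n] pos'[of "Suc n"]
      by (simp add: 0 hyp_coeff_def pochhammer_plus_one pochhammer_Suc[of _ n] mult_ac add.assoc)
  next
    case (Suc j)
    define N where "N = real (n choose j)"
    have "(j + 1) * (n choose (j + 1)) = (n - j) * (n choose j)"
      by (metis Suc_eq_plus1 binomial_absorb_comp binomial_absorption)
    then have "real (j + 1) * real (n choose (j + 1)) = real (n - j) * N"
      unfolding N_def by (metis of_nat_mult)
    also have "\<dots> = (real n - real j) * N"
      by (cases "j \<le> n") (simp_all add: N_def of_nat_diff)
    finally have bin1: "real (n choose Suc j) = N * (real n - real j) / real (Suc j)"
      by (simp add: field_simps)
    have bin2: "real (Suc n choose Suc j) = N * real (Suc n) / real (Suc j)"
      using bin1 by (simp add: N_def field_simps)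
    have shift: "s + 1 + real k = s + real (Suc k)" for s k
      by simp
    define X where "X = (- 1) ^ (n + j) * N * (pochhammer a n * pochhammer b n
        / (pochhammer p n * pochhammer q n))
       * (pochhammer p j * pochhammer q j / (pochhammer a j * pochhammer b j))"
    have e1: "hyp_coeff n (a + 1) (b + 1) (p + 1) (q + 1) j
        = X * (a + real n) * (b + real n) * (p + real j) * (q + real j)
           / ((p + real n) * (q + real n) * (a + real j) * (b + real j))"
      using assms by (simp add: hyp_coeff_def X_def N_def[symmetric] pochhammer_plus_one mult_ac)
    have e2: "hyp_coeff (Suc n) a b p (q + 1) (Suc j)
        = X * real (Suc n) / real (Suc j) * (a + real n) * (b + real n) * (p + real j)
            * (q + real j) * (q + real (Suc j))
           / ((p + real n) * (q + real n) * (q + real (Suc n)) * (a + real j) * (b + real j))"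
      using assms
      by (simp add: hyp_coeff_def X_def bin2 pochhammer_plus_one pochhammer_Suc shift mult_ac
          del: of_nat_Suc binomial_Suc_Suc)
    have e3: "hyp_coeff n a b p q (Suc j)
        = - X * (real n - real j) / real (Suc j) * (p + real j) * (q + real j)
           / ((a + real j) * (b + real j))"
      by (simp add: hyp_coeff_def X_def bin1 pochhammer_Suc mult_ac del: of_nat_Suc)
    show ?thesis
      unfolding Suc coeff_add coeff_smult coeff_pCons_Suc coeff_hyp_poly e1 e2 e3
      using pos'[of n] pos'[of "Suc n"] pos'[of j]
      by (simp add: divide_simps del: of_nat_Suc) (simp add: algebra_simps)
  qed
qed

section \<open>The coefficients\<close>

lemma cprime_add_2: "cprime c d (m + 2) = cprime c d m + 1"
proof -
  have "(m + 2 + 1) div 2 = (m + 1) div 2 + 1" "(m + 2) div 2 = m div 2 + 1"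
    by presburger+
  then show ?thesis
    by (simp add: cprime_def)
qed

lemma cprime_bounds:
  "\<bar>cprime c d m - of_int m / 2\<bar> \<le> \<bar>c\<bar> + \<bar>d\<bar> + 1"
proof (cases "odd m")
  case True
  then obtain k where "m = 2 * k + 1"
    by (rule oddE)
  then show ?thesis
    by (simp add: cprime_def add_divide_distrib)
next
  case False
  then obtain k where "m = 2 * k"
    by (auto elim: evenE)
  then show ?thesis
    by (simp add: cprime_def)
qed

text \<open>From index -1 on, the values are \<open>c\<close> or \<open>d\<close> plus a nonnegative
  integer; at index -2 the value is already d - 1.\<close>

lemma cprime_greater:
  assumes "s < c" "s < d" "m \<ge> -1"
  shows "s < cprime c d m"
proof -
  have "(m + 1) div 2 \<ge> 0" if "odd m"
    using assms by simp
  moreover have "m div 2 \<ge> 0" if "even m"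
    using assms that by presburger
  ultimately show ?thesis
    using assms by (cases "odd m") (auto simp: cprime_def add_strict_increasing2 less_le_trans)
qed

lemma cprime_over_n:
  "(\<lambda>n. cprime c d (int n - l) / real n) \<longlonglongrightarrow> 1 / 2"
proof -
  define K where "K = \<bar>c\<bar> + \<bar>d\<bar> + 1 + \<bar>of_int l / 2\<bar>"
  have "(\<lambda>n. cprime c d (int n - l) / real n - 1 / 2) \<longlonglongrightarrow> 0"
  proof (rule Lim_null_comparison)
    show "\<forall>\<^sub>F n in sequentially. norm (cprime c d (int n - l) / real n - 1 / 2) \<le> K / real n"
      using eventually_gt_at_top[of 0]
    proof eventually_elim
      case (elim n)
      have "\<bar>cprime c d (int n - l) - real n / 2\<bar> \<le> K"
        using cprime_bounds[of c d "int n - l"] by (simp add: K_def diff_divide_distrib)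
      moreover have "cprime c d (int n - l) / real n - 1 / 2 = (cprime c d (int n - l) - real n / 2) / real n"
        using elim by (simp add: diff_divide_distrib)
      ultimately show ?case
        using elim by (simp add: divide_right_mono)
    qed
  qed (rule lim_const_over_n)
  then show ?thesis
    by (rule LIM_zero_cancel)
qed

text \<open>Numerator and denominator are products of three factors of linear growth. As
  \<open>cprime\<close> grows like n / 2, the limit is (1/2) / (3/2)^3 = 4/27 in all three
  cases.\<close>

lemma lam_limits:
  "(\<lambda>n. lam a b c d (3 * n)) \<longlonglongrightarrow> 4 / 27"
  "(\<lambda>n. lam a b c d (3 * n + 1)) \<longlonglongrightarrow> 4 / 27"
  "(\<lambda>n. lam a b c d (3 * n + 2)) \<longlonglongrightarrow> 4 / 27"
proof -
  define p where "p n = cprime c d (int n) / real n" for n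
  define q where "q n = cprime c d (int n - 1) / real n" for n
  define e where "e n = 1 / real n" for n
  have p: "p \<longlonglongrightarrow> 1 / 2" and q: "q \<longlonglongrightarrow> 1 / 2"
    using cprime_over_n[of c d 0] cprime_over_n[of c d 1] by (simp_all add: p_def[abs_def] q_def[abs_def])
  have e: "e \<longlonglongrightarrow> 0"
    unfolding e_def[abs_def] by (rule lim_1_over_n)
  have scale: "x / real n * (y / real n) * (z / real n) / (u / real n * (v / real n) * (w / real n))
      = x * y * z / (u * v * w)" if "n \<ge> 1" for n and x y z u v w :: real
    using that by simp
  have "(\<lambda>n. 1 * (b * e n + 1 - e n) * (p n - a * e n - e n)
      / ((p n + 1 - 2 * e n) * (p n + 1 - e n) * (q n + 1 - e n)))
    \<longlonglongrightarrow> 1 * (b * 0 + 1 - 0) * (1 / 2 - a * 0 - 0) / ((1 / 2 + 1 - 2 * 0) * (1 / 2 + 1 - 0) * (1 / 2 + 1 - 0))"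
    by (intro tendsto_divide tendsto_mult tendsto_add tendsto_diff tendsto_const p q e) simp
  then have "(\<lambda>n. 1 * (b * e n + 1 - e n) * (p n - a * e n - e n)
      / ((p n + 1 - 2 * e n) * (p n + 1 - e n) * (q n + 1 - e n))) \<longlonglongrightarrow> 4 / 27"
    by simp
  moreover have "\<forall>\<^sub>F n in sequentially. 1 * (b * e n + 1 - e n) * (p n - a * e n - e n)
      / ((p n + 1 - 2 * e n) * (p n + 1 - e n) * (q n + 1 - e n)) = lam a b c d (3 * n)"
    using eventually_ge_at_top[of 1]
  proof eventually_elim
    case (elim n)
    show ?case
      unfolding lam_general(1)[OF elim]
      by (subst scale[OF elim, symmetric]) (use elim in \<open>simp add: p_def q_def e_def add_divide_distrib diff_divide_distrib\<close>)
  qed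
  ultimately show "(\<lambda>n. lam a b c d (3 * n)) \<longlonglongrightarrow> 4 / 27"
    by (rule Lim_transform_eventually)
  have "(\<lambda>n. 1 * (a * e n + 1) * (q n - b * e n)
      / ((p n + 1 - e n) * (q n + 1 - e n) * (q n + 1)))
    \<longlonglongrightarrow> 1 * (a * 0 + 1) * (1 / 2 - b * 0) / ((1 / 2 + 1 - 0) * (1 / 2 + 1 - 0) * (1 / 2 + 1))"
    by (intro tendsto_divide tendsto_mult tendsto_add tendsto_diff tendsto_const p q e) simp
  then have "(\<lambda>n. 1 * (a * e n + 1) * (q n - b * e n)
      / ((p n + 1 - e n) * (q n + 1 - e n) * (q n + 1))) \<longlonglongrightarrow> 4 / 27"
    by simp
  moreover have "\<forall>\<^sub>F n in sequentially. 1 * (a * e n + 1) * (q n - b * e n)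
      / ((p n + 1 - e n) * (q n + 1 - e n) * (q n + 1)) = lam a b c d (3 * n + 1)"
    using eventually_ge_at_top[of 1]
  proof eventually_elim
    case (elim n)
    show ?case
      unfolding lam_general(2)[OF elim]
      by (subst scale[OF elim, symmetric]) (use elim in \<open>simp add: p_def q_def e_def add_divide_distrib diff_divide_distrib\<close>)
  qed
  ultimately show "(\<lambda>n. lam a b c d (3 * n + 1)) \<longlonglongrightarrow> 4 / 27"
    by (rule Lim_transform_eventually)
  have "(\<lambda>n. (a * e n + 1) * (b * e n + 1) * (p n - e n)
      / ((p n + 1 - e n) * (p n + 1) * (q n + 1)))
    \<longlonglongrightarrow> (a * 0 + 1) * (b * 0 + 1) * (1 / 2 - 0) / ((1 / 2 + 1 - 0) * (1 / 2 + 1) * (1 / 2 + 1))"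
    by (intro tendsto_divide tendsto_mult tendsto_add tendsto_diff tendsto_const p q e) simp
  then have "(\<lambda>n. (a * e n + 1) * (b * e n + 1) * (p n - e n)
      / ((p n + 1 - e n) * (p n + 1) * (q n + 1))) \<longlonglongrightarrow> 4 / 27"
    by simp
  moreover have "\<forall>\<^sub>F n in sequentially. (a * e n + 1) * (b * e n + 1) * (p n - e n)
      / ((p n + 1 - e n) * (p n + 1) * (q n + 1)) = lam a b c d (3 * n + 2)"
    using eventually_ge_at_top[of 1]
  proof eventually_elim
    case (elim n)
    show ?case
      unfolding lam_general(3)[OF elim]
      by (subst scale[OF elim, symmetric]) (use elim in \<open>simp add: p_def q_def e_def add_divide_distrib diff_divide_distrib\<close>)
  qed
  ultimately show "(\<lambda>n. lam a b c d (3 * n + 2)) \<longlonglongrightarrow> 4 / 27"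
    by (rule Lim_transform_eventually)
qed

text \<open>The separation of \<open>a\<close>, \<open>b\<close> from \<open>c\<close>,
  \<open>d\<close> makes the factors p - a - 1 and q - b positive.\<close>

lemma lam_pos:
  assumes "a > 0" "b > 0" "min c d > max a b"
  shows "n > 0 \<Longrightarrow> lam a b c d (3 * n) > 0"
    "n > 0 \<Longrightarrow> lam a b c d (3 * n + 1) > 0"
    "lam a b c d (3 * n + 2) > 0"
proof -
  have gt: "cprime c d m > a" "cprime c d m > b" "cprime c d m > 0" if "m \<ge> -1" for m
    using assms that by (auto intro!: cprime_greater)
  \<comment> \<open>Makes p - 1 a value of \<open>cprime\<close> at index n - 2, which is at least
    -1 once n is positive, so \<open>gt\<close> covers p - a - 1.\<close>
  have p: "cprime c d (int n) = cprime c d (int n - 2) + 1"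
    using cprime_add_2[of c d "int n - 2"] by simp
  show "lam a b c d (3 * n) > 0" if "n > 0"
  proof -
    have "1 \<le> n" "real n \<ge> 1"
      using that by auto
    moreover have "int n - 2 \<ge> -1" "int n - 1 \<ge> -1"
      using that by auto
    note gt[OF this(1)] gt[OF this(2)]
    ultimately show ?thesis
      using assms by (subst lam_general(1)) (auto simp: p intro!: divide_pos_pos mult_pos_pos)
  qed
  show "lam a b c d (3 * n + 1) > 0" if "n > 0"
  proof -
    have "1 \<le> n" "real n \<ge> 1"
      using that by auto
    moreover have "int n - 2 \<ge> -1" "int n - 1 \<ge> -1"
      using that by auto
    note gt[OF this(1)] gt[OF this(2)]
    ultimately show ?thesis
      using assms by (subst lam_general(2)) (auto simp: p intro!: divide_pos_pos mult_pos_pos)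
  qed
  show "lam a b c d (3 * n + 2) > 0"
  proof (cases "n = 0")
    case True
    then show ?thesis
      using assms by (simp add: lam_def)
  next
    case False
    then have "1 \<le> n" "real n \<ge> 1"
      by auto
    moreover have "int n - 2 \<ge> -1" "int n - 1 \<ge> -1"
      using False by auto
    note gt[OF this(1)] gt[OF this(2)]
    ultimately show ?thesis
      using assms by (subst lam_general(3)) (auto simp: p intro!: divide_pos_pos mult_pos_pos)
  qed
qed

section \<open>Orthogonality and the recurrence\<close>

lemma weight_vector_integrable:
  assumes "a > 0" "b > 0" "c > 0" "d > 0" "min c d > max a b"
  shows "set_integrable lborel {0<..<1} (\<lambda>x. x ^ k * weight_vector a b c d j x)"
  using assms by (auto simp: weight_vector_def intro!: weight_W_moment(1))

text \<open>For \<open>w\<^sub>0\<close> and \<open>w\<^sub>1\<close> alike, \<open>k \<le> l\<close> and \<open>k + j \<le> m\<close> make the denominators of the moments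
  cancel, leaving the alternating binomial sum of a polynomial in the summation index of degree
  \<open>m + l\<close>.\<close>
lemma hyp_poly_orthogonal:
  assumes "a > 0" "b > 0" "c > 0" "d > 0" "min c d > max a b"
    and "j \<in> {0, 1}" "k \<le> l" "k + j \<le> m" "m + l < n"
  shows "(LBINT x:{0<..<1}. x ^ k * poly (hyp_poly n a b (c + real m) (d + real l)) x
           * weight_vector a b c d j x) = 0"
proof -
  let ?Q = "hyp_poly n a b (c + real m) (d + real l)"
  let ?h = "hyp_coeff n a b (c + real m) (d + real l)"
  let ?w = "weight_vector a b c d j"
  \<comment> \<open>One formula for both weights: since \<open>pochhammer b (k + 1)\<close> is
    \<open>b * pochhammer (b + 1) k\<close>, and likewise for \<open>c\<close>, the moments of the
    second weight only shift the indices at \<open>b\<close> and \<open>c\<close>, with c / b going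
    into the constant.\<close>
  obtain \<mu> where \<mu>: "\<And>i. (LBINT x:{0<..<1}. x ^ i * ?w x)
      = \<mu> * (pochhammer a i * pochhammer b (i + j) / (pochhammer c (i + j) * pochhammer d i))"
  proof (cases "j = 0")
    case True
    have "\<exists>\<mu>. \<forall>k. (LBINT x:{0<..<1}. x ^ k * weight_W a b c d x) =
           \<mu> * (pochhammer a k * pochhammer b k / (pochhammer c k * pochhammer d k))"
      using assms by (intro weight_W_moment) auto
    then show ?thesis
      using that True by (auto simp: weight_vector_def)
  next
    case False
    then have j: "j = 1"
      using assms by auto
    have "\<exists>\<mu>. \<forall>k. (LBINT x:{0<..<1}. x ^ k * weight_W a (b + 1) (c + 1) d x) =
           \<mu> * (pochhammer a k * pochhammer (b + 1) k / (pochhammer (c + 1) k * pochhammer d k))"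
      using assms by (intro weight_W_moment) auto
    then obtain \<mu> where "\<And>k. (LBINT x:{0<..<1}. x ^ k * weight_W a (b + 1) (c + 1) d x) =
           \<mu> * (pochhammer a k * pochhammer (b + 1) k / (pochhammer (c + 1) k * pochhammer d k))"
      by blast
    then show ?thesis
      using assms by (intro that[of "\<mu> * c / b"]) (simp add: j weight_vector_def pochhammer_rec)
  qed
  have deg: "degree (monom 1 k * ?Q) = n + k"
  proof -
    have "degree ?Q = n" "?Q \<noteq> 0"
      using assms hyp_poly_monic[of a b n "c + real m" "d + real l"] by force+
    then show ?thesis
      by (simp add: degree_mult_eq degree_monom_eq)
  qed
  have "(LBINT x:{0<..<1}. x ^ k * poly ?Q x * ?w x)
      = (LBINT x:{0<..<1}. poly (monom 1 k * ?Q) x * ?w x)"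
    by (simp add: poly_monom)
  also have "\<dots> = (\<Sum>i\<le>n + k. coeff (monom 1 k * ?Q) i * (LBINT x:{0<..<1}. x ^ i * ?w x))"
    using poly_weight_integral(2)[OF weight_vector_integrable[OF assms(1-5)]]
    by (simp only: deg)
  also have "\<dots> = (\<Sum>i\<in>{k..n + k}. ?h (i - k) * (LBINT x:{0<..<1}. x ^ i * ?w x))"
    by (intro sum.mono_neutral_cong_right) (auto simp: coeff_monom_mult)
  also have "\<dots> = (\<Sum>i\<le>n. ?h i * (LBINT x:{0<..<1}. x ^ (i + k) * ?w x))"
    by (rule sum.reindex_bij_witness[of _ "\<lambda>i. i + k" "\<lambda>i. i - k"]) auto
  also have "\<dots> = \<mu> * (\<Sum>i\<le>n. ?h i * (pochhammer a (i + k) * pochhammer b (i + (k + j))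
      / (pochhammer c (i + (k + j)) * pochhammer d (i + k))))"
    by (simp add: \<mu> sum_distrib_left mult_ac add.assoc)
  also have "\<dots> = 0"
    using assms by (subst hyp_coeff_orthogonal) auto
  finally show ?thesis .
qed

text \<open>Numbering the functional with data k, j by i = 2 k + j turns 2-orthogonality into a
  triangular system with nonzero diagonal, so \<open>biorthogonal_eq_0\<close> applies to
  \<open>Q - P n\<close>.\<close>

lemma monic_2_orthogonal_unique:
  assumes P: "monic_2_orthogonal w P"
    and int: "\<And>j k. set_integrable lborel {0<..<1} (\<lambda>x. x ^ k * w j x)"
    and Q: "degree Q = n" "lead_coeff Q = 1"
      "\<And>j k. j \<in> {0, 1} \<Longrightarrow> n \<ge> 2 * k + j + 1 \<Longrightarrow> (LBINT x:{0<..<1}. x ^ k * poly Q x * w j x) = 0"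
  shows "Q = P n"
proof -
  define \<phi> where "\<phi> i p = (LBINT x:{0<..<1}. x ^ (i div 2) * poly p x * w (i mod 2) x)" for i p
  have \<phi>_int: "set_integrable lborel {0<..<1} (\<lambda>x. x ^ (i div 2) * poly p x * w (i mod 2) x)" for i p
    using poly_weight_integral(1)[of _ "w (i mod 2)" "monom 1 (i div 2) * p", OF int]
    by (simp add: poly_monom)
  have linear: "\<phi> i (p - smult c q) = \<phi> i p - c * \<phi> i q" for i p q c
  proof -
    have "\<phi> i (p - smult c q) = (LBINT x:{0<..<1}. x ^ (i div 2) * poly p x * w (i mod 2) x
        - c * (x ^ (i div 2) * poly q x * w (i mod 2) x))"
      by (simp add: \<phi>_def algebra_simps)
    also have "\<dots> = \<phi> i p - c * \<phi> i q"
      unfolding \<phi>_def using \<phi>_int by (subst set_integral_diff) auto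
    finally show ?thesis .
  qed
  have idx: "i mod 2 \<in> {0, 1}" "2 * (i div 2) + i mod 2 = i" for i :: nat
    by auto
  have monic: "degree (P m) = m" "lead_coeff (P m) = 1" for m
    using P unfolding monic_2_orthogonal_def by blast+
  have "Q - P n = 0"
  proof (rule biorthogonal_eq_0[where \<phi> = \<phi> and P = P, OF linear monic])
    show "\<phi> i (P m) = 0" if "i < m" for i m
      using P idx[of i] that unfolding monic_2_orthogonal_def \<phi>_def
      by (metis Suc_eq_plus1 Suc_leI)
    show "\<phi> i (P i) \<noteq> 0" for i
      using P idx[of i] unfolding monic_2_orthogonal_def \<phi>_def by metis
    show "Q - P n = 0 \<or> degree (Q - P n) < n"
      using Q monic[of n] by (intro eq_zero_or_degree_less degree_diff_le) auto
    show "\<phi> i (Q - P n) = 0" if "i < n" for i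
    proof -
      have "\<phi> i Q = 0"
        using Q(3)[of "i mod 2" "i div 2"] idx[of i] that by (simp add: \<phi>_def)
      moreover have "\<phi> i (P n) = 0"
        using P idx[of i] that unfolding monic_2_orthogonal_def \<phi>_def
        by (metis Suc_eq_plus1 Suc_leI)
      ultimately show ?thesis
        using linear[of i Q 1 "P n"] by simp
    qed
  qed
  then show ?thesis
    by simp
qed

lemma monic_2_orthogonal_weight_vector_eq:
  assumes pos: "a > 0" "b > 0" "c > 0" "d > 0" "min c d > max a b"
    and P: "monic_2_orthogonal (weight_vector a b c d) P"
  shows "P n = hyp_poly n a b (cprime c d (int n - 1)) (cprime c d (int n - 2))"
proof -
  have monic: "degree (P m) = m" "lead_coeff (P m) = 1" for m
    using P unfolding monic_2_orthogonal_def by blast+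
  show ?thesis
  proof (cases "n = 0")
    case True
    then show ?thesis
      using monic[of 0] by (auto elim!: degree_eq_zeroE)
  next
    case False
    \<comment> \<open>These split n - 1 as m + l. The condition 2 k + j + 1 \<le> n then gives
      exactly k + j \<le> m and k \<le> l, and c + m, d + l are the two \<open>cprime\<close>
      values, in an order depending on the parity of n.\<close>
    define m l where "m = n div 2" and "l = (n - 1) div 2"
    have ml: "m + l < n" "m \<le> n div 2" "2 * m + 1 \<ge> n" "2 * l + 2 \<ge> n"
      using False by (auto simp: m_def l_def)
    have Q: "hyp_poly n a b (cprime c d (int n - 1)) (cprime c d (int n - 2))
        = hyp_poly n a b (c + real m) (d + real l)"
    proof (cases "even n")
      case True
      then obtain r where "n = 2 * Suc r"
        using False by (metis evenE mult_0_right not0_implies_Suc)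
      then have "cprime c d (int n - 1) = c + real m" "cprime c d (int n - 2) = d + real l"
        using cprime_odd[of c d "Suc r"] cprime_even[of c d r] by (simp_all add: m_def l_def)
      then show ?thesis
        by simp
    next
      case False
      then obtain r where "n = 2 * r + 1"
        by (rule oddE)
      then have "cprime c d (int n - 2) = c + real m" "cprime c d (int n - 1) = d + real l"
        using cprime_odd[of c d r] cprime_even[of c d r] by (simp_all add: m_def l_def)
      then show ?thesis
        by (simp add: hyp_poly_commute)
    qed
    have "hyp_poly n a b (c + real m) (d + real l) = P n"
    proof (rule monic_2_orthogonal_unique[OF P weight_vector_integrable[OF pos]])
      show "degree (hyp_poly n a b (c + real m) (d + real l)) = n"
        "lead_coeff (hyp_poly n a b (c + real m) (d + real l)) = 1"
        using pos by (auto intro!: hyp_poly_monic simp del: coeff_hyp_poly)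
      show "(LBINT x:{0<..<1}. x ^ k * poly (hyp_poly n a b (c + real m) (d + real l)) x
           * weight_vector a b c d j x) = 0" if "j \<in> {0, 1}" "n \<ge> 2 * k + j + 1" for j k
        using that ml by (intro hyp_poly_orthogonal pos) auto
    qed
    with Q show ?thesis
      by simp
  qed
qed

section \<open>Factorisation of the recurrence into bidiagonal steps\<close>

text \<open>The families \<open>B\<close> and \<open>A\<close> below arise from \<open>Q\<close> by applying the parameter shift
  \<open>(a, b; c, d) \<mapsto> (b, a + 1; d, c + 1)\<close> once and twice; passing from each family to the next is
  bidiagonal.\<close>
lemma hyp_poly_recurrence:
  fixes a b c d :: real
  assumes pos: "a > 0" "b > 0" "min c d > max a b"
  defines "Q \<equiv> (\<lambda>n. hyp_poly n a b (cprime c d (int n - 1)) (cprime c d (int n - 2)))"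
  shows "Q (n + 1) =
       [:- beta_coeff a b c d n, 1:] * Q n
       - (if n \<ge> 1 then smult (alpha_coeff a b c d n) (Q (n - 1)) else 0)
       - (if n \<ge> 2 then smult (gamma_coeff a b c d (n - 1)) (Q (n - 2)) else 0)"
proof -
  let ?e = "cprime c d"
  define B where "B n = hyp_poly n (a + 1) b (?e (int n)) (?e (int n - 1))" for n
  define A where "A n = hyp_poly n (a + 1) (b + 1) (?e (int n + 1)) (?e (int n))" for n
  have e_pos: "?e m > 0" if "m \<ge> -1" for m
    using pos that by (intro cprime_greater) auto
  have e_shift: "?e (int n) = ?e (int n - 2) + 1" "?e (int n + 1) = ?e (int n - 1) + 1" for n
    using cprime_add_2[of c d "int n - 2"] cprime_add_2[of c d "int n - 1"] by (simp_all add: add_ac)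
  \<comment> \<open>Raising q = \<open>?e (n - 1)\<close> by one gives \<open>?e (n + 1)\<close>, so
    the shifted parameters remain consecutive values of \<open>?e\<close>.\<close>
  have QB: "Q (Suc n) = B (Suc n) + smult (lam a b c d (3 * n + 3)) (B n)" for n
  proof -
    have lam: "lam a b c d (3 * n + 3) = real (Suc n) * (b + real n) * (?e (int n - 1) - a)
        / ((?e (int n - 1) + real n) * (?e (int n - 1) + real (Suc n)) * (?e (int n) + real n))"
      using lam_general(1)[of "Suc n" a b c d] e_shift(2)[of n] by (simp add: add_ac)
    show ?thesis
      using hyp_poly_shift_one[of a b "?e (int n)" "?e (int n - 1)" n] pos e_pos
        e_shift(2)[of n]
      unfolding lam by (simp add: Q_def B_def hyp_poly_commute add_ac)
  qed
  \<comment> \<open>The same relation with \<open>a\<close> and \<open>b\<close> in exchanged roles: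
    now \<open>b\<close> and \<open>?e n\<close> are raised.\<close>
  have BA: "B (Suc n) = A (Suc n) + smult (lam a b c d (3 * n + 4)) (A n)" for n
  proof -
    have lam: "lam a b c d (3 * n + 4) = real (Suc n) * (a + 1 + real n) * (?e (int n) - b)
        / ((?e (int n) + real n) * (?e (int n) + real (Suc n)) * (?e (int n + 1) + real n))"
      using lam_general(2)[of "Suc n" a b c d] by (simp add: add_ac mult_ac)
    show ?thesis
      using hyp_poly_shift_one[of b "a + 1" "?e (int n + 1)" "?e (int n)" n] pos e_pos
        e_shift(1)[of "n + 2"]
      unfolding lam by (simp add: A_def B_def hyp_poly_commute add_ac)
  qed
  have AQ: "pCons 0 (A n) = Q (Suc n) + smult (lam a b c d (3 * n + 2)) (Q n)" for n
  proof (cases "n = 0")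
    \<comment> \<open>Here \<open>hyp_poly_shift_all\<close> would be applied with q =
      \<open>?e (-2)\<close> = d - 1, which may fail to be positive; the identity is computed
      directly.\<close>
    case True
    have "?e (-1) = c" "?e 0 = d"
      using cprime_odd[of c d 0] cprime_even[of c d 0] by simp_all
    then show ?thesis
      using True pos
      by (simp add: A_def Q_def hyp_poly_def hyp_coeff_def lam_def monom_altdef)
  next
    case False
    then have n: "n \<ge> 1"
      by simp
    have lam: "lam a b c d (3 * n + 2) = (a + real n) * (b + real n) * ?e (int n - 2)
        / ((?e (int n - 2) + real n) * (?e (int n - 2) + real (Suc n)) * (?e (int n - 1) + real n))"
      using lam_general(3)[OF n, of a b c d] e_shift(1)[of n] by (simp add: add_ac)
    show ?thesis
      using hyp_poly_shift_all[of a b "?e (int n - 1)" "?e (int n - 2)" n] pos e_pos n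
        e_shift[of n]
      unfolding lam by (simp add: A_def Q_def hyp_poly_commute)
  qed
  have B0: "Q 0 = B 0" "B 0 = A 0"
    by (simp_all add: Q_def A_def B_def)
  have lin: "[:- t, 1:] * p = pCons 0 p - smult t p" for t and p :: "real poly"
    by simp
  consider "n = 0" | "n = 1" | m where "n = Suc (Suc m)"
    by (metis One_nat_def not0_implies_Suc)
  then show ?thesis
  proof cases
    case 1
    then show ?thesis
      using AQ[of 0] B0 unfolding lin by (simp add: beta_coeff_def lam_def)
  next
    case 2
    have "pCons 0 (Q 1) = pCons 0 (A 1) + smult (lam a b c d 4) (pCons 0 (A 0))
        + smult (lam a b c d 3) (pCons 0 (A 0))"
      using QB[of 0] BA[of 0] B0 by simp
    then show ?thesis
      using 2 AQ[of 0] AQ[of 1] unfolding lin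
      by (simp add: beta_coeff_def lam_initial(1) lam_initial(2)[unfolded One_nat_def]
          smult_add_left smult_add_right add_ac mult_ac)
  next
    case 3
    \<comment> \<open>Indices are counted from block m = n - 2, so L 6, L 7, L 8 form block n and
      sum to the \<beta> coefficient.\<close>
    define L where "L k = lam a b c d (3 * m + k)" for k
    have L: "L 2 = lam a b c d (3 * m + 2)" "L 4 = lam a b c d (3 * m + 4)"
      "L 5 = lam a b c d (3 * Suc m + 2)" "L 6 = lam a b c d (3 * Suc m + 3)"
      "L 7 = lam a b c d (3 * Suc m + 4)" "L 8 = lam a b c d (3 * Suc (Suc m) + 2)"
      "L 6 = lam a b c d (3 * Suc (Suc m))" "L 7 = lam a b c d (3 * Suc (Suc m) + 1)"
      by (simp_all add: L_def add_ac)
    \<comment> \<open>Two bidiagonal steps expand \<open>Q n\<close> in the family \<open>A\<close>;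
      multiplication by x and \<open>AQ\<close> then lead back to \<open>Q\<close>.\<close>
    have "pCons 0 (Q n) = pCons 0 (A n) + smult (L 7 + L 6) (pCons 0 (A (Suc m)))
        + smult (L 6 * L 4) (pCons 0 (A m))"
      unfolding 3 QB[of "Suc m"] BA[of "Suc m"] BA[of m] L
      by (simp add: smult_add_left smult_add_right mult_ac add_ac)
    also have "\<dots> = Q (n + 1) + smult (beta_coeff a b c d n) (Q n)
        + smult (L 5 * (L 7 + L 6) + L 6 * L 4) (Q (Suc m)) + smult (L 6 * L 4 * L 2) (Q m)"
      unfolding 3 AQ beta_coeff_def L
      by (simp add: smult_add_left smult_add_right algebra_simps)
    also have "L 5 * (L 7 + L 6) + L 6 * L 4 = alpha_coeff a b c d n"
      by (simp add: 3 L_def algebra_simps)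
    also have "L 6 * L 4 * L 2 = gamma_coeff a b c d (n - 1)"
      by (simp add: 3 L_def mult_ac)
    finally show ?thesis
      unfolding lin by (simp add: 3 algebra_simps)
  qed
qed

theorem theorem3p5:
  fixes a b c d :: real and P :: "nat \<Rightarrow> real poly"
  assumes "a > 0" "b > 0" "c > 0" "d > 0"
    and "min c d > max a b"
    and "monic_2_orthogonal (weight_vector a b c d) P"
  shows "P 0 = 1 \<and>
    (\<forall>n. P (n + 1) =
       [:- beta_coeff a b c d n, 1:] * P n
       - (if n \<ge> 1 then smult (alpha_coeff a b c d n) (P (n - 1)) else 0)
       - (if n \<ge> 2 then smult (gamma_coeff a b c d (n - 1)) (P (n - 2)) else 0)) \<and>
    (\<forall>n. beta_coeff a b c d n > 0 \<and> alpha_coeff a b c d (n + 1) > 0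
         \<and> gamma_coeff a b c d (n + 1) > 0) \<and>
    bounded (range (\<lambda>n. beta_coeff a b c d n)) \<and>
    bounded (range (\<lambda>n. alpha_coeff a b c d (n + 1))) \<and>
    bounded (range (\<lambda>n. gamma_coeff a b c d (n + 1))) \<and>
    (\<lambda>n. beta_coeff a b c d n) \<longlonglongrightarrow> 3 * (4 / 27) \<and> 3 * (4 / 27) = (4 / 9 :: real) \<and>
    (\<lambda>n. alpha_coeff a b c d n) \<longlonglongrightarrow> 3 * (4 / 27)\<^sup>2 \<and> 3 * (4 / 27)\<^sup>2 = (16 / 243 :: real) \<and>
    (\<lambda>n. gamma_coeff a b c d n) \<longlonglongrightarrow> (4 / 27) ^ 3 \<and> (4 / 27) ^ 3 = (64 / 19683 :: real)"
proof -
  note pos = assms(1-5)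
  let ?l = "lam a b c d"
  let ?\<beta> = "beta_coeff a b c d" and ?\<alpha> = "alpha_coeff a b c d" and ?\<gamma> = "gamma_coeff a b c d"
  have P: "P = (\<lambda>n. hyp_poly n a b (cprime c d (int n - 1)) (cprime c d (int n - 2)))"
    using monic_2_orthogonal_weight_vector_eq[OF assms] by blast
  \<comment> \<open>Only weak inequalities hold, as the first two entries of block 0 vanish;
    strictness of the \<beta> and \<alpha> coefficients comes from the other entries.\<close>
  have nonneg: "?l (3 * n) \<ge> 0" "?l (3 * n + 1) \<ge> 0" for n
    using lam_pos(1,2)[OF pos(1,2,5), of n] lam_initial(1,2)[of a b c d]
    by (cases "n = 0"; simp add: less_imp_le)+
  have lam: "?l (3 * n + 2) > 0" "?l (3 * n + 3) > 0" "?l (3 * n + 4) > 0" "?l (3 * n + 6) > 0" for n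
    using lam_pos(3)[OF pos(1,2,5), of n] lam_pos(1,2)[OF pos(1,2,5), of "Suc n"]
      lam_pos(1)[OF pos(1,2,5), of "Suc (Suc n)"]
    by (simp_all add: add_ac)
  have beta_pos: "?\<beta> n > 0" for n
    using nonneg[of n] lam(1)[of n] by (simp add: beta_coeff_def)
  have alpha_pos: "?\<alpha> (n + 1) > 0" for n
    using nonneg(2)[of n] lam[of n] by (simp add: add_nonneg_pos add_pos_pos)
  have gamma_pos: "?\<gamma> (n + 1) > 0" for n
    using lam[of n] by simp
  have beta_lim: "?\<beta> \<longlonglongrightarrow> 3 * (4 / 27)"
  proof -
    have "?\<beta> \<longlonglongrightarrow> 4 / 27 + 4 / 27 + 4 / 27"
      unfolding beta_coeff_def[abs_def] by (intro tendsto_add lam_limits)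
    then show ?thesis
      by simp
  qed
  have idx: "3 * n + 3 = 3 * Suc n" "3 * n + 4 = 3 * Suc n + 1" "3 * n + 6 = 3 * Suc (Suc n)" for n
    by simp_all
  have L: "(\<lambda>n. ?l (3 * n + 3)) \<longlonglongrightarrow> 4 / 27" "(\<lambda>n. ?l (3 * n + 4)) \<longlonglongrightarrow> 4 / 27"
      "(\<lambda>n. ?l (3 * n + 6)) \<longlonglongrightarrow> 4 / 27"
    unfolding idx
    by (rule LIMSEQ_Suc[OF lam_limits(1)] LIMSEQ_Suc[OF lam_limits(2)]
      LIMSEQ_Suc[OF LIMSEQ_Suc[OF lam_limits(1)]])+
  have alpha_lim: "(\<lambda>n. ?\<alpha> (Suc n)) \<longlonglongrightarrow> 3 * (4 / 27)\<^sup>2"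
  proof -
    have "(\<lambda>n. ?\<alpha> (Suc n)) \<longlonglongrightarrow> 4 / 27 * (4 / 27) + 4 / 27 * (4 / 27) + 4 / 27 * (4 / 27)"
      unfolding alpha_coeff.simps
      by (intro tendsto_add tendsto_mult L lam_limits)
    then show ?thesis
      by (simp add: power2_eq_square)
  qed
  have gamma_lim: "(\<lambda>n. ?\<gamma> (Suc n)) \<longlonglongrightarrow> (4 / 27) ^ 3"
  proof -
    have "(\<lambda>n. ?\<gamma> (Suc n)) \<longlonglongrightarrow> 4 / 27 * (4 / 27) * (4 / 27)"
      unfolding gamma_coeff.simps
      by (intro tendsto_mult L lam_limits)
    then show ?thesis
      by (simp add: power3_eq_cube)
  qed
  note beta_pos alpha_pos gamma_pos beta_lim
  \<comment> \<open>The limits are shifted back by one index, which the conventional values at 0 do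
    not affect.\<close>
  moreover have "?\<alpha> \<longlonglongrightarrow> 3 * (4 / 27)\<^sup>2" "?\<gamma> \<longlonglongrightarrow> (4 / 27) ^ 3"
    using LIMSEQ_imp_Suc[OF alpha_lim] LIMSEQ_imp_Suc[OF gamma_lim] .
  moreover have "bounded (range ?\<beta>)" "bounded (range (\<lambda>n. ?\<alpha> (n + 1)))"
      "bounded (range (\<lambda>n. ?\<gamma> (n + 1)))"
    using convergent_imp_bounded[OF beta_lim] convergent_imp_bounded[OF alpha_lim]
      convergent_imp_bounded[OF gamma_lim] by simp_all
  moreover have "P 0 = 1"
    by (simp add: P)
  moreover have "P (n + 1) = [:- ?\<beta> n, 1:] * P n
       - (if n \<ge> 1 then smult (?\<alpha> n) (P (n - 1)) else 0)
       - (if n \<ge> 2 then smult (?\<gamma> (n - 1)) (P (n - 2)) else 0)" for n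
    unfolding P by (rule hyp_poly_recurrence[OF pos(1,2,5)])
  moreover have "3 * (4 / 27) = (4 / 9 :: real)" "3 * (4 / 27)\<^sup>2 = (16 / 243 :: real)"
    "(4 / 27) ^ 3 = (64 / 19683 :: real)"
    by (simp_all add: power2_eq_square power3_eq_cube)
  ultimately show ?thesis
    by blast
qed

end
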